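(* Suppose CGCARE($\Sigma$) admits a solution $X=X^{\top}\in\mathbb{R}^{n\times n}$. Then $\mathcal{S}^\star=\mathcal{R}^\star$, where $\mathcal{S}^\star$ is the smallest input-containing subspace and $\mathcal{R}^\star$ is the largest reachability output-nulling subspace of the quadruple $(A,B,C,D)$.
   Context: Let $A,Q\in\mathbb{R}^{n\times n}$, $B,S\in\mathbb{R}^{n\times m}$, $R\in\mathbb{R}^{m\times m}$, with standing assumption $\Pi=\begin{bmatrix} Q & S\\ S^{\top} & R\end{bmatrix}=\Pi^{\top}\ge 0$ (positive semidefinite; $R$ may be singular). $M^{\dagger}$ denotes the Moore-Penrose pseudo-inverse. CGCARE($\Sigma$) (constrained generalised continuous algebraic Riccati equation) is the pair of conditions on $X\in\mathbb{R}^{n\times n}$: $$XA+A^{\top}X-(S+XB)R^{\dagger}(S^{\top}+B^{\top}X)+Q=0,\qquad \ker R\subseteq\ker(S+XB).$$ $C\in\mathbb{R}^{p\times n}$ and $D\in\mathbb{R}^{p\times m}$ are matrices of suitable sizes such that $\Pi=\begin{bmatrix} C^{\top}\\ D^{\top}\end{bmatrix}\begin{bmatrix} C & D\end{bmatrix}$, i.e. $Q=C^{\top}C$, $S=C^{\top}D$, $R=D^{\top}D$. The quadruple $(A,B,C,D)$ stands for the system $\dot x=Ax+Bu$, $y=Cx+Du$. Standard geometric notions: a subspace $\mathcal{S}\subseteq\mathbb{R}^n$ is input-containing for $(A,B,C,D)$ if there exists $L\in\mathbb{R}^{n\times p}$ with $(A+LC)\mathcal{S}\subseteq\mathcal{S}$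 and $\operatorname{im}(B+LD)\subseteq\mathcal{S}$; $\mathcal{S}^\star$ is the smallest such subspace. $\mathcal{R}^\star$ is the set of states $x_1\in\mathbb{R}^n$ that can be reached from the origin in finite time by an ordinary (impulse-free) input such that the output $y$ is identically zero along the way. *)

theory Defs
  imports "HOL-Analysis.Analysis"
begin

text \<open>The Moore-Penrose pseudo-inverse, given by the four Penrose equations, which have exactly
  one solution for every real matrix.\<close>

definition is_mp_inverse :: "real^'a^'b \<Rightarrow> real^'b^'a \<Rightarrow> bool" where
  "is_mp_inverse M P \<longleftrightarrow>
     M ** P ** M = M \<and> P ** M ** P = P \<and>
     transpose (M ** P) = M ** P \<and> transpose (P ** M) = P ** M"

definition mp_inverse :: "real^'a^'b \<Rightarrow> real^'b^'a" where
  "mp_inverse M = (THE P. is_mp_inverse M P)"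

definition mat_ker :: "real^'a^'b \<Rightarrow> (real^'a) set" where
  "mat_ker M = {v. M *v v = 0}"

definition mat_im :: "real^'a^'b \<Rightarrow> (real^'b) set" where
  "mat_im M = range (\<lambda>v. M *v v)"

definition popov_matrix ::
    "real^'n^'n \<Rightarrow> real^'m^'n \<Rightarrow> real^'m^'m \<Rightarrow> real^('n + 'm)^('n + 'm)" where
  "popov_matrix Q S R = (\<chi> i j.
     case i of
       Inl a \<Rightarrow> (case j of Inl b \<Rightarrow> Q $ a $ b | Inr d \<Rightarrow> S $ a $ d)
     | Inr c \<Rightarrow> (case j of Inl b \<Rightarrow> transpose S $ c $ b | Inr d \<Rightarrow> R $ c $ d))"

text \<open>The block row \<open>[C D]\<close>.\<close>

definition block_row :: "real^'n^'p \<Rightarrow> real^'m^'p \<Rightarrow> real^('n + 'm)^'p" where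
  "block_row C D = (\<chi> i j. case j of Inl b \<Rightarrow> C $ i $ b | Inr d \<Rightarrow> D $ i $ d)"

definition pos_semidef :: "real^'a^'a \<Rightarrow> bool" where
  "pos_semidef M \<longleftrightarrow> (\<forall>v. 0 \<le> v \<bullet> (M *v v))"

lemma popov_matrix_factorization:
  "popov_matrix Q S R = transpose (block_row C D) ** block_row C D \<longleftrightarrow>
     Q = transpose C ** C \<and> S = transpose C ** D \<and> R = transpose D ** D"
  (is "?lhs \<longleftrightarrow> ?rhs")
proof -
  have "?lhs \<longleftrightarrow>
     (Q = transpose C ** C \<and> S = transpose C ** D) \<and>
     (transpose S = transpose D ** C \<and> R = transpose D ** D)"
    unfolding popov_matrix_def block_row_def transpose_def matrix_matrix_mult_def vec_eq_iff
    by (simp add: split_sum_all all_conj_distrib)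
  moreover have "S = transpose C ** D \<Longrightarrow> transpose S = transpose D ** C"
    by (simp add: matrix_transpose_mul)
  ultimately show ?thesis by blast
qed

definition cgcare ::
    "real^'n^'n \<Rightarrow> real^'m^'n \<Rightarrow> real^'n^'n \<Rightarrow> real^'m^'n \<Rightarrow> real^'m^'m \<Rightarrow> real^'n^'n \<Rightarrow> bool" where
  "cgcare A B Q S R X \<longleftrightarrow>
     X ** A + transpose A ** X
       - (S + X ** B) ** mp_inverse R ** (transpose S + transpose B ** X) + Q = 0 \<and>
     mat_ker R \<subseteq> mat_ker (S + X ** B)"

definition input_containing ::
    "real^'n^'n \<Rightarrow> real^'m^'n \<Rightarrow> real^'n^'p \<Rightarrow> real^'m^'p \<Rightarrow> (real^'n) set \<Rightarrow> bool" where
  "input_containing A B C D V \<longleftrightarrow>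
     subspace V \<and>
     (\<exists>L :: real^'p^'n.
        (\<lambda>v. (A + L ** C) *v v) ` V \<subseteq> V \<and> mat_im (B + L ** D) \<subseteq> V)"

text \<open>\<open>LEAST\<close> is with respect to set inclusion: the input-containing subspace that is contained in
  every other one.\<close>

definition S_star ::
    "real^'n^'n \<Rightarrow> real^'m^'n \<Rightarrow> real^'n^'p \<Rightarrow> real^'m^'p \<Rightarrow> (real^'n) set" where
  "S_star A B C D = (LEAST V. input_containing A B C D V)"

text \<open>An ordinary input is a Lebesgue integrable function on the time interval. Accordingly
  \<open>x' = A x + B u\<close>, \<open>x(0) = x0\<close> is understood in the sense of Caratheodory, as an integral
  equation; \<open>t = 0\<close> gives the initial condition, and \<open>x\<close> is absolutely continuous, being an
  indefinite integral.\<close>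

definition trajectory ::
    "real^'n^'n \<Rightarrow> real^'m^'n \<Rightarrow> real^'n \<Rightarrow> real \<Rightarrow> (real \<Rightarrow> real^'m) \<Rightarrow> (real \<Rightarrow> real^'n) \<Rightarrow> bool" where
  "trajectory A B x0 T u x \<longleftrightarrow>
     u absolutely_integrable_on {0..T} \<and>
     (\<forall>t\<in>{0..T}. ((\<lambda>s. A *v x s + B *v u s) has_integral (x t - x0)) {0..t})"

definition R_star ::
    "real^'n^'n \<Rightarrow> real^'m^'n \<Rightarrow> real^'n^'p \<Rightarrow> real^'m^'p \<Rightarrow> (real^'n) set" where
  "R_star A B C D =
     {x1. \<exists>T>0. \<exists>u x. trajectory A B 0 T u x \<and> x T = x1 \<and>
            (\<forall>t\<in>{0..T}. C *v x t + D *v u t = 0)}"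

end

theory Submission
  imports Defs
begin

text \<open>Let \<open>N = S + X B\<close>, \<open>K = R\<^sup>\<dagger> N\<^sup>T\<close>, \<open>F = A - B K\<close>, and let \<open>R\<^sub>0\<close> be the smallest \<open>F\<close>-invariant
  subspace that contains \<open>B (ker D)\<close>. For \<open>X v = 0\<close> the Riccati equation gives
  \<open>X F v = - C\<^sup>T (C - D K) v\<close> and \<open>D\<^sup>T (C - D K) v = 0\<close>, so that
  \<open>\<bar>(C - D K) v\<bar>\<^sup>2 = - v\<^sup>T X F v = 0\<close>. Hence \<open>ker X\<close> is \<open>F\<close>-invariant, and it contains
  \<open>B (ker D)\<close>. So \<open>R\<^sub>0\<close> lies in \<open>ker X\<close>, and the feedback \<open>u = w - K x\<close> with \<open>w \<in> ker D\<close> keeps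
  the output zero on it.

  With \<open>L = - B R\<^sup>\<dagger> D\<^sup>T\<close> the image of \<open>B + L D\<close> is \<open>B (ker D)\<close>, so \<open>R\<^sub>0\<close> is input-containing; as
  \<open>C = D K\<close> on \<open>R\<^sub>0\<close>, it is the smallest such subspace. An output-nulling trajectory from the
  origin stays in every input-containing subspace, because there
  \<open>A x + B u = (A + L C) x + (B + L D) u\<close>. Conversely, continuing trajectories under the feedback
  and differentiating the endpoint shows that the output-nulling reachable states form an
  \<open>F\<close>-invariant subspace containing \<open>B (ker D)\<close>.\<close>

section \<open>Matrix algebra, orthogonal projectors and the pseudo-inverse\<close>

lemma matrix_add_rdistrib: "(A + B) ** C = A ** C + (B ** C :: real^'a^'b)"
  by (simp add: matrix_matrix_mult_def vec_eq_iff sum.distrib algebra_simps)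

lemma matrix_diff_ldistrib: "A ** (B - C) = A ** B - (A ** C :: real^'a^'b)"
  by (simp add: matrix_matrix_mult_def vec_eq_iff sum_subtractf algebra_simps)

lemma matrix_diff_rdistrib: "(A - B) ** C = A ** C - (B ** C :: real^'a^'b)"
  by (simp add: matrix_matrix_mult_def vec_eq_iff sum_subtractf algebra_simps)

lemma orthogonal_projector_exists:
  fixes V :: "(real^'n) set"
  assumes "subspace V"
  obtains P :: "real^'n^'n" where "transpose P = P" "\<And>v. P *v v \<in> V" "\<And>v. v \<in> V \<Longrightarrow> P *v v = v"
proof -
  obtain E where E: "E \<subseteq> V" "pairwise orthogonal E" "\<And>x. x \<in> E \<Longrightarrow> norm x = 1"
      "independent E" "span E = V"
    using orthonormal_basis_subspace[OF assms] by metis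
  define P :: "real^'n^'n" where "P = (\<chi> i j. \<Sum>e\<in>E. e $ i * e $ j)"
  have P: "P *v v = (\<Sum>e\<in>E. (e \<bullet> v) *\<^sub>R e)" for v
    unfolding vec_eq_iff P_def matrix_vector_mult_def inner_vec_def
    by (auto simp: sum_distrib_right sum_component sum_distrib_left intro!: sum.cong
        intro: trans[OF sum.swap] simp: mult_ac)
  show thesis
  proof
    show "transpose P = P" by (simp add: P_def transpose_def vec_eq_iff mult.commute)
    show "P *v v \<in> V" for v
      unfolding P using E(1) assms by (auto intro!: subspace_sum subspace_scale)
    show "P *v v = v" if "v \<in> V" for v
    proof -
      have "(\<Sum>e\<in>E. (e \<bullet> v / (e \<bullet> e)) *\<^sub>R e) = P *v v"
        unfolding P using E(3) by (auto intro!: sum.cong simp: dot_square_norm)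
      moreover have "v - P *v v \<in> span E"
        using \<open>\<And>v. P *v v \<in> V\<close> that assms E(5) by (simp add: subspace_diff)
      \<comment> \<open>The Gram-Schmidt residual \<open>v - P v\<close> is orthogonal to all of
        \<open>span E\<close>, and for \<open>v\<close> in \<open>V\<close> it also lies in
        \<open>span E\<close>. It is therefore orthogonal to itself.\<close>
      ultimately have "orthogonal (v - P *v v) (v - P *v v)"
        using Gram_Schmidt_step[OF E(2), of "v - P *v v" v] by simp
      then show ?thesis by (simp add: orthogonal_self)
    qed
  qed
qed

text \<open>Since \<open>M P' M = M\<close>, the product of \<open>M P'\<close> and
  \<open>M P\<close> is \<open>M P\<close>; transposing it, with both factors symmetric, gives
  \<open>M P M P' = M P'\<close>, so the two projectors coincide. Transposition carries this over to
  \<open>P M = P' M\<close>, and then \<open>P = P M P = P' M P' = P'\<close>.\<close>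

lemma is_mp_inverse_unique:
  assumes "is_mp_inverse M P" "is_mp_inverse M P'"
  shows "P = P'"
proof -
  have *: "M ** P = M ** P'" if "is_mp_inverse M P" "is_mp_inverse M P'"
    for M :: "real^'x^'y" and P P'
  proof -
    have "M ** P = transpose ((M ** P') ** (M ** P))"
      using that by (simp add: is_mp_inverse_def matrix_mul_assoc)
    also have "\<dots> = (M ** P) ** (M ** P')"
      using that by (simp add: is_mp_inverse_def matrix_transpose_mul)
    also have "\<dots> = M ** P'"
      using that by (simp add: is_mp_inverse_def matrix_mul_assoc)
    finally show ?thesis .
  qed
  have tr: "is_mp_inverse (transpose M) (transpose Q)" if "is_mp_inverse M Q" for Q
    using that by (simp add: is_mp_inverse_def matrix_transpose_mul matrix_mul_assoc) 
       (metis matrix_transpose_mul matrix_mul_assoc)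
  have 1: "M ** P = M ** P'" using assms by (rule *)
  have "transpose M ** transpose P = transpose M ** transpose P'"
    using assms[THEN tr] by (rule *)
  then have 2: "P ** M = P' ** M"
    by (metis matrix_transpose_mul transpose_transpose)
  have "P = P ** M ** P" using assms by (simp add: is_mp_inverse_def)
  also have "\<dots> = P' ** M ** P'" using 1 2 by (metis matrix_mul_assoc)
  also have "\<dots> = P'" using assms by (simp add: is_mp_inverse_def)
  finally show ?thesis .
qed

text \<open>If \<open>E\<close> is the orthogonal projector onto the kernel of the symmetric matrix \<open>R\<close>, then \<open>R + E\<close>
  is invertible and the pseudo-inverse is \<open>(R + E)\<^sup>-\<^sup>1 - E\<close>.\<close>

lemma is_mp_inverse_mp_inverse_symmetric:
  fixes R :: "real^'m^'m"
  assumes "transpose R = R"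
  shows "is_mp_inverse R (mp_inverse R)"
proof -
  have "subspace (mat_ker R)"
    unfolding mat_ker_def subspace_def by (simp add: matrix_vector_right_distrib matrix_vector_mult_scaleR)
  then obtain E where E: "transpose E = E" "\<And>v. E *v v \<in> mat_ker R" "\<And>v. v \<in> mat_ker R \<Longrightarrow> E *v v = v"
    using orthogonal_projector_exists by metis
  have RE: "R ** E = 0"
    using E(2) by (simp add: matrix_eq mat_ker_def flip: matrix_vector_mul_assoc)
  have ER: "E ** R = 0"
    using arg_cong[OF RE, of transpose] assms E(1)
    by (simp add: matrix_transpose_mul) (simp add: transpose_def vec_eq_iff)
  have EE: "E ** E = E"
    using E(2,3) by (simp add: matrix_eq flip: matrix_vector_mul_assoc)
  have "v = 0" if "(R + E) *v v = 0" for v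
  proof -
    \<comment> \<open>Multiplying by \<open>E\<close> removes \<open>R\<close> and leaves
      \<open>E v = 0\<close>, hence also \<open>R v = 0\<close>. As \<open>E\<close> fixes kernel
      vectors, \<open>v = E v = 0\<close>.\<close>
    have "E *v ((R + E) *v v) = E *v v"
      using ER EE by (simp add: matrix_vector_mul_assoc matrix_add_ldistrib)
    then have "E *v v = 0" using that by simp
    then have "R *v v = 0" using that by (simp add: matrix_vector_mult_add_rdistrib)
    then show "v = 0" using E(3)[of v] \<open>E *v v = 0\<close> by (simp add: mat_ker_def)
  qed
  then obtain J where J: "J ** (R + E) = mat 1"
    using matrix_left_invertible_ker[of "R + E"] by blast
  then have J': "(R + E) ** J = mat 1" using matrix_left_right_inverse by blast
  have JE: "J ** E = E"
  proof -
    have "J ** E = J ** ((R + E) ** E)" by (simp add: RE EE matrix_add_rdistrib)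
    then show ?thesis by (simp add: matrix_mul_assoc J)
  qed
  have EJ: "E ** J = E"
  proof -
    have "E ** J = (E ** (R + E)) ** J" by (simp add: ER EE matrix_add_ldistrib)
    then show ?thesis by (simp add: J' flip: matrix_mul_assoc)
  qed
  have JR: "J ** R = mat 1 - E"
    using J JE by (simp add: matrix_add_ldistrib eq_diff_eq)
  have RJ: "R ** J = mat 1 - E"
    using J' EJ by (simp add: matrix_add_rdistrib eq_diff_eq)
  have 1: "R ** (J - E) = mat 1 - E"
    by (simp add: matrix_diff_ldistrib RJ RE)
  have 2: "(J - E) ** R = mat 1 - E"
    by (simp add: matrix_diff_rdistrib JR ER)
  have "transpose (mat 1 - E) = mat 1 - E"
    using E(1) by (simp add: transpose_def mat_def vec_eq_iff)
  then have "is_mp_inverse R (J - E)"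
    unfolding is_mp_inverse_def 1 2
    by (simp add: matrix_diff_ldistrib matrix_diff_rdistrib ER EJ EE)
  then show ?thesis
    unfolding mp_inverse_def by (metis is_mp_inverse_unique theI')
qed

section \<open>Linear differential equations: invariant subspaces and existence of solutions\<close>

text \<open>The complementary projection \<open>P\<close> vanishes on \<open>V\<close>, so it
  removes the forcing term and satisfies \<open>P F = P F P\<close>. Thus \<open>z = P x\<close>
  solves a homogeneous linear equation with zero initial value and must vanish.\<close>

lemma has_integral_invariant_subspace:
  fixes F :: "real^'n^'n" and T :: real
  assumes V: "subspace V" "\<And>v. v \<in> V \<Longrightarrow> F *v v \<in> V"
    and g: "\<And>t. t \<in> {0..T} \<Longrightarrow> g t \<in> V" and "\<xi> \<in> V" and "0 \<le> T"
    and x: "\<And>t. t \<in> {0..T} \<Longrightarrow> ((\<lambda>s. F *v x s + g s) has_integral (x t - \<xi>)) {0..t}"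
  shows "x T \<in> V"
proof -
  obtain E where E: "\<And>v. E *v v \<in> V" "\<And>v. v \<in> V \<Longrightarrow> E *v v = v"
    using orthogonal_projector_exists[OF V(1)] by metis
  define P where "P = mat 1 - E"
  have P_apply: "P *v v = v - E *v v" for v
    by (simp add: P_def matrix_vector_mult_diff_rdistrib)
  have P0: "P *v v = 0" if "v \<in> V" for v using E(2)[OF that] by (simp add: P_apply)
  define G where "G = P ** F"
  define z where "z t = P *v x t" for t
  have PF: "P *v (F *v v) = G *v (P *v v)" for v
  proof -
    have "P *v (F *v (E *v v)) = 0" using P0 V(2) E(1) by blast
    then show ?thesis
      by (simp add: G_def P_apply matrix_vector_mult_diff_distrib flip: matrix_vector_mul_assoc)
  qed
  have z_int: "((\<lambda>s. G *v z s) has_integral z t) {0..t}" if t: "t \<in> {0..T}" for t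
  proof -
    have "((\<lambda>s. P *v (F *v x s + g s)) has_integral P *v (x t - \<xi>)) {0..t}"
      using has_integral_linear[OF x[OF t] matrix_vector_mul_bounded_linear[of P]] by (simp add: o_def)
    moreover have "P *v (x t - \<xi>) = z t"
      using P0[OF \<open>\<xi> \<in> V\<close>] by (simp add: z_def matrix_vector_mult_diff_distrib)
    ultimately have "((\<lambda>s. P *v (F *v x s + g s)) has_integral z t) {0..t}" by simp
    moreover have "P *v (F *v x s + g s) = G *v z s" if "s \<in> {0..t}" for s
    proof -
      have "s \<in> {0..T}" using that t by auto
      then have "P *v g s = 0" by (intro P0 g)
      then show ?thesis by (simp add: z_def PF matrix_vector_right_distrib)
    qed
    ultimately show ?thesis by (rule has_integral_eq[rotated])
  qed
  have z_eq: "z t = integral {0..t} (\<lambda>s. G *v z s)" if "t \<in> {0..T}" for t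
    using z_int[OF that] by (simp add: integral_unique)
  \<comment> \<open>No regularity of \<open>x\<close> is assumed. As an indefinite integral
    \<open>z\<close> is continuous, so its integrand \<open>G z\<close> is continuous too, and this
    makes \<open>z\<close> differentiable.\<close>
  have cont: "continuous_on {0..T} z"
  proof -
    have "(\<lambda>s. G *v z s) integrable_on {0..T}" using z_int[of T] \<open>0 \<le> T\<close> by auto
    from indefinite_integral_continuous_1[OF this] show ?thesis
      by (rule continuous_on_eq) (rule z_eq[symmetric])
  qed
  have "continuous_on {0..T} (\<lambda>s. G *v z s)"
    by (rule bounded_linear.continuous_on[OF matrix_vector_mul_bounded_linear cont])
  from integral_has_vector_derivative[OF this]
  have "(z has_vector_derivative G *v z t) (at t within {0..T})" if "t \<in> {0..T}" for t
    by (rule has_vector_derivative_transform[rotated 2]) (use that z_eq in auto)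
  then have deriv: "(z has_vector_derivative G *v z t) (at t)" if "0 < t" "t < T" for t
    using that at_within_Icc_at[OF that] by (metis atLeastAtMost_iff less_imp_le)
  obtain c where c: "\<And>v. norm (G *v v) \<le> c * norm v"
    using bounded_linear.bounded[OF matrix_vector_mul_bounded_linear[of G]] by (metis mult.commute)
  \<comment> \<open>Gronwall: \<open>z\<close> solves \<open>z' = G z\<close> with \<open>z 0 = 0\<close>, so this weighted square norm decreases.\<close>
  define f where "f t = exp (- (2 * c) * t) * (z t \<bullet> z t)" for t
  have "f T \<le> f 0"
  proof (rule DERIV_nonpos_imp_decreasing_open[OF \<open>0 \<le> T\<close>])
    show "continuous_on {0..T} f" unfolding f_def by (intro continuous_intros cont)
    fix t assume t: "0 < t" "t < T"
    have "((\<lambda>t. z t \<bullet> z t) has_real_derivative 2 * (z t \<bullet> (G *v z t))) (at t)"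
      using bounded_bilinear.has_vector_derivative[OF bounded_bilinear_inner deriv[OF t] deriv[OF t]]
      by (simp add: has_real_derivative_iff_has_vector_derivative inner_commute)
    then have "(f has_real_derivative exp (- (2 * c) * t) * (2 * (z t \<bullet> (G *v z t)) - 2 * c * (z t \<bullet> z t))) (at t)"
      unfolding f_def by (auto intro!: derivative_eq_intros simp: algebra_simps)
    moreover have "exp (- (2 * c) * t) * (2 * (z t \<bullet> (G *v z t)) - 2 * c * (z t \<bullet> z t)) \<le> 0"
    proof -
      have "z t \<bullet> (G *v z t) \<le> norm (z t) * norm (G *v z t)" by (rule norm_cauchy_schwarz)
      also have "\<dots> \<le> norm (z t) * (c * norm (z t))" by (intro mult_left_mono c) simp
      also have "\<dots> = c * (z t \<bullet> z t)" by (simp add: dot_square_norm power2_eq_square)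
      finally show ?thesis by (intro mult_nonneg_nonpos) auto
    qed
    ultimately show "\<exists>y. DERIV f t :> y \<and> y \<le> 0" by blast
  qed
  moreover have "z 0 = 0" using z_eq[of 0] \<open>0 \<le> T\<close> by simp
  ultimately have "exp (- (2 * c) * T) * (z T \<bullet> z T) \<le> 0" by (simp add: f_def)
  then have "z T \<bullet> z T \<le> 0" by (simp add: mult_le_0_iff)
  then have "z T = 0" using inner_ge_zero[of "z T"] by (metis inner_eq_zero_iff order_antisym)
  then show ?thesis using E(1)[of "x T"] by (simp add: z_def P_apply)
qed

text \<open>The solution is a power series in \<open>t\<close>. Comparing coefficients gives the
  recursion for \<open>a\<close>, in which \<open>b\<close> enters only at the first step; the
  factorial bound makes the series converge for all \<open>t\<close>.\<close>

lemma affine_ode_solution_exists: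
  fixes F :: "real^'n^'n"
  obtains x where "x 0 = x0" "\<And>t. (x has_vector_derivative F *v x t + b) (at t)"
proof -
  obtain c where c: "\<And>v. norm (F *v v) \<le> c * norm v"
    using bounded_linear.bounded[OF matrix_vector_mul_bounded_linear[of F]] by (metis mult.commute)
  \<comment> \<open>With \<open>k\<close> at least 1, \<open>norm b\<close> is bounded by
    \<open>k * norm b\<close>, so the first step of the recursion obeys the same bound
    \<open>M * k ^ n / fact n\<close> as the later ones.\<close>
  define k where "k = max 1 c"
  have k: "norm (F *v v) \<le> k * norm v" "1 \<le> k" for v
    using order_trans[OF c mult_right_mono[of c k "norm v"]] by (auto simp: k_def)
  define a where "a = rec_nat x0 (\<lambda>n v. (1 / real (Suc n)) *\<^sub>R (F *v v + (if n = 0 then b else 0)))"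
  have a0: "a 0 = x0"
    and aS: "a (Suc n) = (1 / real (Suc n)) *\<^sub>R (F *v a n + (if n = 0 then b else 0))" for n
    by (simp_all add: a_def)
  define M where "M = norm x0 + norm b"
  have bound: "norm (a n) \<le> M * (k ^ n / fact n)" for n
  proof (induction n)
    case (Suc n)
    have "norm (F *v a n + (if n = 0 then b else 0)) \<le> M * k ^ Suc n / fact n"
    proof (cases "n = 0")
      case True
      have "norm (F *v x0 + b) \<le> k * norm x0 + k * norm b"
        using k(1)[of x0] k(2) mult_right_mono[of 1 k "norm b"] norm_triangle_ineq[of "F *v x0" b] by simp
      then show ?thesis using True by (simp add: a0 M_def algebra_simps)
    next
      case False
      have "norm (F *v a n) \<le> k * (M * (k ^ n / fact n))"
        using k(1)[of "a n"] Suc.IH k(2) by (meson mult_left_mono order_trans zero_le_one)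
      then show ?thesis using False by (simp add: mult_ac)
    qed
    then have "norm (F *v a n + (if n = 0 then b else 0)) / real (Suc n)
        \<le> (M * k ^ Suc n / fact n) / real (Suc n)"
      by (rule divide_right_mono) simp
    moreover have "norm (a (Suc n)) = norm (F *v a n + (if n = 0 then b else 0)) / real (Suc n)"
      unfolding aS by simp
    ultimately show ?case
      by (simp add: mult_ac)
  qed (simp add: a0 M_def)
  have summ: "summable (\<lambda>n. a n $ i * t ^ n)" for i t
  proof (rule summable_comparison_test')
    show "summable (\<lambda>n. M * (inverse (fact n) * (k * \<bar>t\<bar>) ^ n))"
      by (intro summable_mult summable_exp)
    have "norm (a n $ i * t ^ n) \<le> (M * (k ^ n / fact n)) * \<bar>t\<bar> ^ n" for n
      using mult_right_mono[OF order_trans[OF component_le_norm_cart[of "a n" i] bound], of "\<bar>t\<bar> ^ n"]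
      by (simp add: abs_mult power_abs)
    then show "norm (a n $ i * t ^ n) \<le> M * (inverse (fact n) * (k * \<bar>t\<bar>) ^ n)" if "n \<ge> 0" for n
      by (simp add: power_mult_distrib field_simps)
  qed
  define x :: "real \<Rightarrow> real^'n" where "x t = (\<chi> i. \<Sum>n. a n $ i * t ^ n)" for t
  have x_comp: "((\<lambda>t. x t $ i) has_real_derivative (F *v x t + b) $ i) (at t)" for i t
  proof -
    \<comment> \<open>This is \<open>x' = F x + b\<close> read coefficientwise: \<open>b\<close>
      contributes only to the constant term of the derivative series.\<close>
    have eq: "diffs (\<lambda>n. a n $ i) n * t ^ n
        = (\<Sum>j\<in>UNIV. F $ i $ j * (a n $ j * t ^ n)) + (if n = 0 then b $ i else 0)" for n
      by (auto simp: diffs_def aS matrix_vector_mult_def sum_distrib_left mult_ac distrib_left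
          simp del: of_nat_Suc)
    have "(\<lambda>n. if n = 0 then b $ i else 0) sums (b $ i)"
      using sums_single[of 0 "\<lambda>_. b $ i"] by simp
    moreover have "(\<lambda>n. \<Sum>j\<in>UNIV. F $ i $ j * (a n $ j * t ^ n)) sums (F *v x t) $ i"
      unfolding matrix_vector_mult_def x_def
      using summ by (auto intro!: sums_sum sums_mult summable_sums)
    ultimately have "(\<Sum>n. diffs (\<lambda>n. a n $ i) n * t ^ n) = (F *v x t + b) $ i"
      unfolding eq by (simp add: sums_add sums_unique[symmetric])
    then show ?thesis
      using termdiffs_strong_converges_everywhere[OF summ, of i t] by (simp add: x_def)
  qed
  show thesis
  proof
    show "x 0 = x0" by (simp add: x_def vec_eq_iff a0)
    show "(x has_vector_derivative F *v x t + b) (at t)" for t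
      unfolding has_vector_derivative_def has_derivative_componentwise_within[of x]
      using x_comp[of _ t] unfolding has_real_derivative_iff_has_vector_derivative has_vector_derivative_def
      by (auto simp: Basis_vec_def inner_axis)
  qed
qed

section \<open>Concatenation of trajectories\<close>

lemma has_integral_concat:
  fixes f g :: "real \<Rightarrow> 'a::euclidean_space"
  assumes "(f has_integral i) {0..a}" "(g has_integral j) {0..b}" "0 \<le> a" "0 \<le> b"
  shows "((\<lambda>t. if t \<le> a then f t else g (t - a)) has_integral (i + j)) {0..a + b}"
proof (rule has_integral_combine[of 0 a])
  show "((\<lambda>t. if t \<le> a then f t else g (t - a)) has_integral i) {0..a}"
    by (rule has_integral_eq[OF _ assms(1)]) simp
  have "((\<lambda>t. g (t - a)) has_integral j) {a..a + b}"
    using has_integral_shift_real_ivl[OF assms(2), of "- a"] by (simp add: add.commute)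
  \<comment> \<open>At \<open>t = a\<close> the concatenation takes the value \<open>f a\<close>
    instead of \<open>g 0\<close>; a single point does not affect the integral.\<close>
  then show "((\<lambda>t. if t \<le> a then f t else g (t - a)) has_integral j) {a..a + b}"
    by (rule has_integral_spike_finite[of "{a}", rotated 2]) auto
qed (use assms in auto)

lemma absolutely_integrable_concat:
  fixes f g :: "real \<Rightarrow> 'a::euclidean_space"
  assumes "f absolutely_integrable_on {0..a}" "g absolutely_integrable_on {0..b}" "0 \<le> a" "0 \<le> b"
  shows "(\<lambda>t. if t \<le> a then f t else g (t - a)) absolutely_integrable_on {0..a + b}"
proof -
  have *: "(\<lambda>t. if t \<le> a then h t else k (t - a)) integrable_on {0..a + b}"
    if "h integrable_on {0..a}" "k integrable_on {0..b}" for h k :: "real \<Rightarrow> 'c::euclidean_space"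
    using has_integral_concat[OF that[THEN integrable_integral] assms(3,4)] by (rule has_integral_integrable)
  show ?thesis
    using assms(1,2) *[of f g] *[of "\<lambda>t. norm (f t)" "\<lambda>t. norm (g t)"]
    unfolding absolutely_integrable_on_def if_distrib[of norm] by auto
qed

text \<open>The two integrals telescope at \<open>x1 T1\<close>, the end of the first piece and the
  initial state of the second.\<close>

lemma trajectory_concat:
  assumes tr1: "trajectory A B x0 T1 u1 x1" and tr2: "trajectory A B (x1 T1) T2 u2 x2"
    and "0 \<le> T1" "0 \<le> T2"
  shows "trajectory A B x0 (T1 + T2) (\<lambda>t. if t \<le> T1 then u1 t else u2 (t - T1))
           (\<lambda>t. if t \<le> T1 then x1 t else x2 (t - T1))"
    (is "trajectory A B x0 _ ?u ?x")
  unfolding trajectory_def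
proof
  show "?u absolutely_integrable_on {0..T1 + T2}"
    using assms by (intro absolutely_integrable_concat) (auto simp: trajectory_def)
  let ?f = "\<lambda>s. A *v ?x s + B *v ?u s"
  let ?f1 = "\<lambda>s. A *v x1 s + B *v u1 s" and ?f2 = "\<lambda>s. A *v x2 s + B *v u2 s"
  have f: "?f = (\<lambda>s. if s \<le> T1 then ?f1 s else ?f2 (s - T1))" by auto
  show "\<forall>t\<in>{0..T1 + T2}. (?f has_integral (?x t - x0)) {0..t}"
  proof
    fix t assume t: "t \<in> {0..T1 + T2}"
    show "(?f has_integral (?x t - x0)) {0..t}"
    proof (cases "t \<le> T1")
      case True
      then have "(?f1 has_integral (x1 t - x0)) {0..t}" using tr1 t by (simp add: trajectory_def)
      then show ?thesis using True by (auto intro: has_integral_eq[rotated])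
    next
      case False
      have "(?f1 has_integral (x1 T1 - x0)) {0..T1}"
        using tr1 \<open>0 \<le> T1\<close> by (simp add: trajectory_def)
      moreover have "(?f2 has_integral (x2 (t - T1) - x1 T1)) {0..t - T1}"
        using tr2 False t by (simp add: trajectory_def)
      ultimately have "(?f has_integral (x1 T1 - x0 + (x2 (t - T1) - x1 T1))) {0..T1 + (t - T1)}"
        unfolding f using False by (intro has_integral_concat \<open>0 \<le> T1\<close>) auto
      then show ?thesis using False by simp
    qed
  qed
qed

section \<open>Output-nulling trajectories and the subspace \<open>R_star\<close>\<close>

text \<open>The initial state is a parameter, so that a trajectory from the origin can be continued
  from its endpoint.\<close>

definition output_nulling_trajectory ::
    "real^'n^'n \<Rightarrow> real^'m^'n \<Rightarrow> real^'n^'p \<Rightarrow> real^'m^'p \<Rightarrow> real^'n \<Rightarrow> real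
      \<Rightarrow> (real \<Rightarrow> real^'m) \<Rightarrow> (real \<Rightarrow> real^'n) \<Rightarrow> bool" where
  "output_nulling_trajectory A B C D x0 T u x \<longleftrightarrow>
     trajectory A B x0 T u x \<and> (\<forall>t\<in>{0..T}. C *v x t + D *v u t = 0)"

lemma mem_R_star_iff:
  "x1 \<in> R_star A B C D \<longleftrightarrow> (\<exists>T>0. \<exists>u x. output_nulling_trajectory A B C D 0 T u x \<and> x T = x1)"
  by (auto simp: R_star_def output_nulling_trajectory_def)

text \<open>\<open>0 < T2\<close> puts the final time strictly after \<open>T1\<close>, where the
  second branch defines the state; the switching time itself belongs to the first piece.\<close>

lemma output_nulling_trajectory_concat:
  assumes "output_nulling_trajectory A B C D x0 T1 u1 x1"
    and "output_nulling_trajectory A B C D (x1 T1) T2 u2 x2"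
    and "0 \<le> T1" "0 < T2"
  obtains u x where "output_nulling_trajectory A B C D x0 (T1 + T2) u x" "x (T1 + T2) = x2 T2"
proof
  show "output_nulling_trajectory A B C D x0 (T1 + T2) (\<lambda>t. if t \<le> T1 then u1 t else u2 (t - T1))
           (\<lambda>t. if t \<le> T1 then x1 t else x2 (t - T1))"
    using assms trajectory_concat[of A B x0 T1 u1 x1 T2 u2 x2] unfolding output_nulling_trajectory_def by auto
qed (use assms in auto)

lemma output_nulling_trajectory_zero: "output_nulling_trajectory A B C D 0 T (\<lambda>_. 0) (\<lambda>_. 0)"
  by (simp add: output_nulling_trajectory_def trajectory_def)

lemma output_nulling_trajectory_add:
  assumes "output_nulling_trajectory A B C D x0 T u x" "output_nulling_trajectory A B C D y0 T v y"
  shows "output_nulling_trajectory A B C D (x0 + y0) T (\<lambda>t. u t + v t) (\<lambda>t. x t + y t)"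
proof -
  have "((\<lambda>s. A *v (x s + y s) + B *v (u s + v s)) has_integral (x t + y t - (x0 + y0))) {0..t}"
    if "t \<in> {0..T}" for t
  proof -
    have "((\<lambda>s. (A *v x s + B *v u s) + (A *v y s + B *v v s)) has_integral ((x t - x0) + (y t - y0))) {0..t}"
      using assms that
      by (intro has_integral_add) (auto simp: output_nulling_trajectory_def trajectory_def)
    then show ?thesis by (simp add: matrix_vector_right_distrib algebra_simps)
  qed
  moreover have "C *v (x t + y t) + D *v (u t + v t) = 0" if "t \<in> {0..T}" for t
  proof -
    have "(C *v x t + D *v u t) + (C *v y t + D *v v t) = 0"
      using assms that by (simp add: output_nulling_trajectory_def)
    then show ?thesis by (simp add: matrix_vector_right_distrib algebra_simps)
  qed
  ultimately show ?thesis
    using assms by (auto simp: output_nulling_trajectory_def trajectory_def)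
qed

lemma output_nulling_trajectory_scaleR:
  assumes "output_nulling_trajectory A B C D x0 T u x"
  shows "output_nulling_trajectory A B C D (c *\<^sub>R x0) T (\<lambda>t. c *\<^sub>R u t) (\<lambda>t. c *\<^sub>R x t)"
proof -
  have "((\<lambda>s. A *v (c *\<^sub>R x s) + B *v (c *\<^sub>R u s)) has_integral (c *\<^sub>R x t - c *\<^sub>R x0)) {0..t}"
    if "t \<in> {0..T}" for t
  proof -
    have "((\<lambda>s. c *\<^sub>R (A *v x s + B *v u s)) has_integral c *\<^sub>R (x t - x0)) {0..t}"
      using assms that
      by (intro has_integral_cmul) (auto simp: output_nulling_trajectory_def trajectory_def)
    then show ?thesis by (simp add: matrix_vector_mult_scaleR algebra_simps)
  qed
  moreover have "C *v (c *\<^sub>R x t) + D *v (c *\<^sub>R u t) = 0" if "t \<in> {0..T}" for t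
  proof -
    have "c *\<^sub>R (C *v x t + D *v u t) = 0"
      using assms that by (simp add: output_nulling_trajectory_def)
    then show ?thesis by (simp add: matrix_vector_mult_scaleR scaleR_add_right)
  qed
  ultimately show ?thesis
    using assms by (auto simp: output_nulling_trajectory_def trajectory_def)
qed

text \<open>Starting from the origin one may wait there, so a longer time horizon reaches more.\<close>

lemma output_nulling_trajectory_longer:
  assumes "output_nulling_trajectory A B C D 0 T u x" "0 < T" "T \<le> T'"
  obtains v y where "output_nulling_trajectory A B C D 0 T' v y" "y T' = x T"
  using output_nulling_trajectory_concat[OF output_nulling_trajectory_zero assms(1), of "T' - T"] assms(2,3)
  by auto

lemma subspace_R_star: "subspace (R_star A B C D)"
  unfolding subspace_def
proof (intro conjI ballI allI)
  show "0 \<in> R_star A B C D"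
    unfolding mem_R_star_iff using output_nulling_trajectory_zero zero_less_one by metis
next
  fix a b assume "a \<in> R_star A B C D" "b \<in> R_star A B C D"
  then obtain T T' u u' x x' where
    1: "output_nulling_trajectory A B C D 0 T u x" "T > 0" "x T = a"
    and 2: "output_nulling_trajectory A B C D 0 T' u' x'" "T' > 0" "x' T' = b"
    unfolding mem_R_star_iff by metis
  \<comment> \<open>The two states may be reached at different times. Waiting at the origin brings
    both to the common horizon \<open>m\<close>, where trajectories can be superposed.\<close>
  define m where "m = max T T'"
  obtain v y where 3: "output_nulling_trajectory A B C D 0 m v y" "y m = a"
    using output_nulling_trajectory_longer[OF 1(1,2), of m] 1(3) by (auto simp: m_def)
  obtain v' y' where 4: "output_nulling_trajectory A B C D 0 m v' y'" "y' m = b"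
    using output_nulling_trajectory_longer[OF 2(1,2), of m] 2(3) by (auto simp: m_def)
  have "m > 0" using 1(2) by (simp add: m_def)
  then show "a + b \<in> R_star A B C D"
    unfolding mem_R_star_iff
    using output_nulling_trajectory_add[OF 3(1) 4(1)] 3(2) 4(2) 
    by (intro exI[of _ m] conjI exI[of _ "\<lambda>t. v t + v' t"] exI[of _ "\<lambda>t. y t + y' t"]) auto
next
  fix c a assume "a \<in> R_star A B C D"
  then show "c *\<^sub>R a \<in> R_star A B C D"
    unfolding mem_R_star_iff using output_nulling_trajectory_scaleR[of A B C D 0 _ _ _ c] by fastforce
qed

lemma R_star_extend:
  assumes "x0 \<in> R_star A B C D" "output_nulling_trajectory A B C D x0 T u x" "0 < T"
  shows "x T \<in> R_star A B C D"
proof -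
  obtain T0 u0 y where "output_nulling_trajectory A B C D 0 T0 u0 y" "T0 > 0" "y T0 = x0"
    using assms(1) unfolding mem_R_star_iff by metis
  then show ?thesis
    unfolding mem_R_star_iff 
    using output_nulling_trajectory_concat[of A B C D 0 T0 u0 y T u x] assms(2,3)
    by (metis add_pos_pos less_imp_le)
qed

text \<open>Output injection through \<open>L\<close> is invisible while the output is zero. The
  state then obeys an equation whose matrix \<open>A + L C\<close> preserves \<open>V\<close> and
  whose forcing term lies in \<open>V\<close>.\<close>

lemma R_star_subset_input_containing:
  assumes "input_containing A B C D V"
  shows "R_star A B C D \<subseteq> V"
proof
  fix x1 assume "x1 \<in> R_star A B C D"
  then obtain T u x where T: "T > 0" and tr: "trajectory A B 0 T u x"
    and out: "\<And>t. t \<in> {0..T} \<Longrightarrow> C *v x t + D *v u t = 0" and "x T = x1"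
    by (auto simp: R_star_def)
  obtain L where V: "subspace V" "\<And>v. v \<in> V \<Longrightarrow> (A + L ** C) *v v \<in> V"
      "\<And>w. (B + L ** D) *v w \<in> V"
    using assms by (auto simp: input_containing_def mat_im_def image_subset_iff)
  have "x T \<in> V"
  proof (rule has_integral_invariant_subspace[OF V(1,2), where \<xi> = 0 and T = T and x = x and g = "\<lambda>t. (B + L ** D) *v u t"])
    show "0 \<in> V" using V(1) by (rule subspace_0)
    show "(B + L ** D) *v u t \<in> V" for t by (rule V(3))
    fix t assume t: "t \<in> {0..T}"
    have "A *v x s + B *v u s = (A + L ** C) *v x s + (B + L ** D) *v u s" if "s \<in> {0..t}" for s
    proof -
      have "L *v (C *v x s + D *v u s) = 0" using out[of s] that t by simp
      then show ?thesis
        by (simp add: matrix_vector_mult_add_rdistrib matrix_vector_right_distrib algebra_simps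
            flip: matrix_vector_mul_assoc)
    qed
    moreover have "((\<lambda>s. A *v x s + B *v u s) has_integral (x t - 0)) {0..t}"
      using tr t by (simp add: trajectory_def)
    ultimately show "((\<lambda>s. (A + L ** C) *v x s + (B + L ** D) *v u s) has_integral (x t - 0)) {0..t}"
      by (rule has_integral_eq)
  qed (use T in auto)
  then show "x1 \<in> V" by (simp add: \<open>x T = x1\<close>)
qed

section \<open>Right derivatives, smallest invariant subspaces and adjoints\<close>

text \<open>Finite-dimensional subspaces are closed and contain the difference quotients at positive
  times. One side suffices, which fits trajectories that run only forward in time.\<close>

lemma subspace_right_derivative:
  fixes f :: "real \<Rightarrow> 'a::euclidean_space"
  assumes "subspace V" "f 0 \<in> V" "\<And>t. 0 < t \<Longrightarrow> f t \<in> V" "(f has_vector_derivative d) (at 0)"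
  shows "d \<in> V"
proof (rule Lim_in_closed_set[OF closed_subspace[OF assms(1)]])
  have "((\<lambda>t. (f t - f 0) /\<^sub>R t) \<longlongrightarrow> d) (at 0)"
  proof -
    have "((\<lambda>t. norm (f t - f 0 - t *\<^sub>R d) / \<bar>t\<bar>) \<longlongrightarrow> 0) (at 0)"
      using assms(4) by (simp add: has_vector_derivative_def has_derivative_iff_norm)
    moreover have "\<forall>\<^sub>F t in at 0. norm (f t - f 0 - t *\<^sub>R d) / \<bar>t\<bar> = norm ((f t - f 0) /\<^sub>R t - d)"
      unfolding eventually_at_filter
    proof (intro always_eventually allI impI)
      fix t :: real assume "t \<noteq> 0"
      then have "(f t - f 0) /\<^sub>R t - d = (f t - f 0 - t *\<^sub>R d) /\<^sub>R t"
        by (simp add: scaleR_diff_right)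
      then show "norm (f t - f 0 - t *\<^sub>R d) / \<bar>t\<bar> = norm ((f t - f 0) /\<^sub>R t - d)"
        by (simp add: divide_inverse_commute)
    qed
    ultimately have "((\<lambda>t. norm ((f t - f 0) /\<^sub>R t - d)) \<longlongrightarrow> 0) (at 0)"
      by (rule Lim_transform_eventually)
    then show ?thesis by (rule LIM_zero_cancel[OF tendsto_norm_zero_cancel])
  qed
  then show "((\<lambda>t. (f t - f 0) /\<^sub>R t) \<longlongrightarrow> d) (at_right 0)"
    by (rule tendsto_mono[OF at_le, rotated]) simp
  show "\<forall>\<^sub>F t in at_right 0. (f t - f 0) /\<^sub>R t \<in> V"
    using eventually_at_right_less[of 0]
    by eventually_elim (intro subspace_scale subspace_diff assms; simp)
qed simp

text \<open>This is the span of all \<open>F^k W\<close>; for \<open>W\<close> the range of an input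
  matrix it is the classical reachable subspace of the pair. The intersection form makes minimality
  immediate.\<close>

definition controllable_subspace :: "real^'n^'n \<Rightarrow> (real^'n) set \<Rightarrow> (real^'n) set" where
  "controllable_subspace F W = \<Inter>{V. subspace V \<and> (\<forall>v\<in>V. F *v v \<in> V) \<and> W \<subseteq> V}"

lemma controllable_subspace_least:
  assumes "subspace V" "\<And>v. v \<in> V \<Longrightarrow> F *v v \<in> V" "W \<subseteq> V"
  shows "controllable_subspace F W \<subseteq> V"
  using assms unfolding controllable_subspace_def by blast

lemma subspace_controllable_subspace: "subspace (controllable_subspace F W)"
  unfolding controllable_subspace_def by (auto intro: subspace_Inter)

lemma controllable_subspace_invariant:
  "v \<in> controllable_subspace F W \<Longrightarrow> F *v v \<in> controllable_subspace F W"
  unfolding controllable_subspace_def by blast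

lemma subset_controllable_subspace: "W \<subseteq> controllable_subspace F W"
  unfolding controllable_subspace_def by blast

text \<open>The adjoint identity, phrased with \<open>v*\<close> because simplification turns
  \<open>transpose M *v y\<close> into \<open>y v* M\<close>.\<close>

lemma inner_vector_matrix_mult: "x \<bullet> (y v* M) = (M *v x) \<bullet> (y :: real^'p)"
  by (metis dot_lmul_matrix inner_commute)

lemma ker_transpose_mult_self: "mat_ker (transpose D ** D) = mat_ker (D :: real^'m^'p)"
proof -
  have "D *v w = 0" if "transpose D *v (D *v w) = 0" for w
  proof -
    have "(D *v w) \<bullet> (D *v w) = w \<bullet> (transpose D *v (D *v w))"
      by (simp add: inner_vector_matrix_mult)
    then show ?thesis using that by simp
  qed
  then show ?thesis by (auto simp: mat_ker_def simp flip: matrix_vector_mul_assoc)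
qed

section \<open>Geometry of an output-nulling feedback\<close>

text \<open>The Riccati equation enters the geometric argument only through this property of
  \<open>K\<close>: under the feedback, states of the smallest invariant subspace produce no
  output.\<close>

locale output_nulling_feedback =
  fixes A :: "real^'n^'n" and B :: "real^'m^'n" and C :: "real^'n^'p" and D :: "real^'m^'p"
    and K :: "real^'n^'m"
  assumes output_nulling:
    "\<And>v. v \<in> controllable_subspace (A - B ** K) ((*v) B ` mat_ker D) \<Longrightarrow> (C - D ** K) *v v = 0"
begin

abbreviation "F \<equiv> A - B ** K"
abbreviation "R\<^sub>0 \<equiv> controllable_subspace F ((*v) B ` mat_ker D)"

lemma closed_loop: "(C - D ** K) *v v + D *v w = C *v v + D *v (w - K *v v)"
  "F *v v + B *v w = A *v v + B *v (w - K *v v)"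
  by (simp_all add: matrix_vector_mult_diff_rdistrib matrix_vector_right_distrib
      matrix_vector_mult_diff_distrib algebra_simps flip: matrix_vector_mul_assoc)

text \<open>On \<open>R\<^sub>0\<close> the output-nulling identity gives
  \<open>F v = (A + L C) v - (B + L D) K v\<close>. It is available only there, so minimality is
  applied to \<open>V \<inter> R\<^sub>0\<close> instead of \<open>V\<close>.\<close>

lemma R0_subset_input_containing:
  assumes "input_containing A B C D V"
  shows "R\<^sub>0 \<subseteq> V"
proof -
  obtain L where V: "subspace V" "\<And>v. v \<in> V \<Longrightarrow> (A + L ** C) *v v \<in> V"
      "\<And>w. (B + L ** D) *v w \<in> V"
    using assms by (auto simp: input_containing_def mat_im_def image_subset_iff)
  have "R\<^sub>0 \<subseteq> V \<inter> R\<^sub>0"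
  proof (rule controllable_subspace_least)
    show "subspace (V \<inter> R\<^sub>0)" by (intro subspace_inter V subspace_controllable_subspace)
    show "F *v v \<in> V \<inter> R\<^sub>0" if v: "v \<in> V \<inter> R\<^sub>0" for v
    proof
      have "L *v ((C - D ** K) *v v) = 0" using output_nulling v by simp
      then have "F *v v = (A + L ** C) *v v - (B + L ** D) *v (K *v v)"
        by (simp add: matrix_vector_mult_diff_rdistrib matrix_vector_mult_add_rdistrib
            matrix_vector_mult_diff_distrib flip: matrix_vector_mul_assoc)
      then show "F *v v \<in> V" using v V by (auto intro: subspace_diff)
      show "F *v v \<in> R\<^sub>0" using v by (auto intro: controllable_subspace_invariant)
    qed
    have "B *v w \<in> V" if "w \<in> mat_ker D" for w
      using V(3)[of w] that
      by (simp add: mat_ker_def matrix_vector_mult_add_rdistrib flip: matrix_vector_mul_assoc)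
    then show "(*v) B ` mat_ker D \<subseteq> V \<inter> R\<^sub>0"
      using subset_controllable_subspace by blast
  qed
  then show ?thesis by simp
qed

lemma input_containing_R0:
  assumes "\<And>w. (B + L ** D) *v w \<in> R\<^sub>0"
  shows "input_containing A B C D R\<^sub>0"
proof -
  have "(A + L ** C) *v v \<in> R\<^sub>0" if v: "v \<in> R\<^sub>0" for v
  proof -
    have "L *v ((C - D ** K) *v v) = 0" using output_nulling v by simp
    then have "(A + L ** C) *v v = F *v v + (B + L ** D) *v (K *v v)"
      by (simp add: matrix_vector_mult_diff_rdistrib matrix_vector_mult_add_rdistrib
          matrix_vector_mult_diff_distrib flip: matrix_vector_mul_assoc)
    then show ?thesis
      using assms v by (simp add: controllable_subspace_invariant subspace_add subspace_controllable_subspace)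
  qed
  then show ?thesis
    using assms subspace_controllable_subspace by (auto simp: input_containing_def mat_im_def)
qed

text \<open>The vector is the initial velocity under the feedback with constant \<open>w\<close>,
  and every later state on that path is reachable. Taking \<open>w = 0\<close> yields
  \<open>F\<close>-invariance of \<open>R_star\<close>, taking \<open>x0 = 0\<close> yields that it
  contains \<open>B (ker D)\<close>.\<close>

lemma R_star_right_derivative:
  assumes x0: "x0 \<in> R_star A B C D" "x0 \<in> R\<^sub>0" and w: "w \<in> mat_ker D"
  shows "F *v x0 + B *v w \<in> R_star A B C D"
proof -
  obtain x where x: "x 0 = x0" "\<And>t. (x has_vector_derivative F *v x t + B *v w) (at t)"
    using affine_ode_solution_exists by metis
  have cont: "continuous_on S x" for S
    using x(2) by (meson continuous_at_imp_continuous_on has_vector_derivative_continuous)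
  have int: "((\<lambda>s. F *v x s + B *v w) has_integral (x t - x0)) {0..t}" if "0 \<le> t" for t
    using fundamental_theorem_of_calculus[OF that has_vector_derivative_at_within[OF x(2)]] x(1) by simp
  \<comment> \<open>The forcing term \<open>B w\<close> lies in \<open>R\<^sub>0\<close>, so
    \<open>x\<close> never leaves this subspace and the output-nulling identity holds along
    it.\<close>
  have inv: "x t \<in> R\<^sub>0" if "0 \<le> t" for t
  proof (rule has_integral_invariant_subspace[OF subspace_controllable_subspace controllable_subspace_invariant,
        where \<xi> = x0 and T = t and x = x and g = "\<lambda>_. B *v w"])
    show "B *v w \<in> R\<^sub>0" using w subset_controllable_subspace by blast
  qed (use x0 int that in auto)
  define u where "u t = w - K *v x t" for t
  \<comment> \<open>A trajectory that reaches \<open>x0\<close> can be continued along \<open>x\<close> with zero output.\<close>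
  have "x t \<in> R_star A B C D" if "0 < t" for t
  proof (rule R_star_extend[OF x0(1)])
    have "u absolutely_integrable_on {0..t}"
      unfolding u_def
      using bounded_linear.continuous_on[OF matrix_vector_mul_bounded_linear cont]
      by (intro absolutely_integrable_continuous_real continuous_on_diff continuous_on_const)
    moreover have "C *v x s + D *v u s = 0" if "s \<in> {0..t}" for s
      using output_nulling[OF inv, of s] that w closed_loop(1)[of "x s" w] by (simp add: u_def mat_ker_def)
    ultimately show "output_nulling_trajectory A B C D x0 t u x"
      unfolding output_nulling_trajectory_def trajectory_def
      using int by (simp add: u_def flip: closed_loop(2))
  qed (rule that)
  then show ?thesis
    using subspace_right_derivative[OF subspace_R_star, of x] x x0(1) by metis
qed

theorem S_star_eq_R_star:
  assumes "\<And>w. (B + L ** D) *v w \<in> R\<^sub>0"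
  shows "S_star A B C D = R_star A B C D"
proof -
  have "S_star A B C D = R\<^sub>0"
    unfolding S_star_def
    by (intro Least_equality input_containing_R0[OF assms] R0_subset_input_containing)
  moreover have sub: "R_star A B C D \<subseteq> R\<^sub>0"
    by (rule R_star_subset_input_containing[OF input_containing_R0[OF assms]])
  moreover have "R\<^sub>0 \<subseteq> R_star A B C D"
  proof (rule controllable_subspace_least[OF subspace_R_star])
    show "F *v v \<in> R_star A B C D" if "v \<in> R_star A B C D" for v
      using R_star_right_derivative[of v 0] that sub by (auto simp: mat_ker_def)
    have "B *v w \<in> R_star A B C D" if "w \<in> mat_ker D" for w
      using R_star_right_derivative[of 0 w] that
      by (simp add: subspace_0 subspace_R_star subspace_controllable_subspace)
    then show "(*v) B ` mat_ker D \<subseteq> R_star A B C D" by auto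
  qed
  ultimately show ?thesis by simp
qed

end

section \<open>From the Riccati equation to the output-nulling feedback\<close>

theorem proposition3p1:
  fixes A Q :: "real^'n^'n"
    and B S :: "real^'m^'n"
    and R :: "real^'m^'m"
    and C :: "real^'n^'p"
    and D :: "real^'m^'p"
  assumes "popov_matrix Q S R = transpose (popov_matrix Q S R)"
    and "pos_semidef (popov_matrix Q S R)"
    and "popov_matrix Q S R = transpose (block_row C D) ** block_row C D"
    and "\<exists>X :: real^'n^'n. X = transpose X \<and> cgcare A B Q S R X"
  shows "S_star A B C D = R_star A B C D"
proof -
  have Q: "Q = transpose C ** C" and S: "S = transpose C ** D" and R: "R = transpose D ** D"
    using assms(3) unfolding popov_matrix_factorization by auto
  obtain X where X: "transpose X = X"
    and care: "X ** A + transpose A ** X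
       - (S + X ** B) ** mp_inverse R ** (transpose S + transpose B ** X) + Q = 0"
    and ker: "mat_ker R \<subseteq> mat_ker (S + X ** B)"
    using assms(4) unfolding cgcare_def by metis
  define N where "N = S + X ** B"
  define P where "P = mp_inverse R"
  define K where "K = P ** transpose N"
  have trN: "transpose N = transpose S + transpose B ** X"
  proof -
    have "transpose N = transpose S + transpose (X ** B)"
      by (simp add: N_def transpose_def vec_eq_iff)
    then show ?thesis by (simp add: matrix_transpose_mul X)
  qed
  have trR: "transpose R = R" by (simp add: R matrix_transpose_mul)
  have "is_mp_inverse R P"
    unfolding P_def by (rule is_mp_inverse_mp_inverse_symmetric[OF trR])
  then have RPR: "R ** P ** R = R" and RP: "transpose (R ** P) = R ** P"
    by (simp_all add: is_mp_inverse_def)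
  have proj: "w - P *v (R *v w) \<in> mat_ker R" for w
    by (simp add: mat_ker_def matrix_vector_mult_diff_distrib matrix_vector_mul_assoc matrix_mul_assoc RPR)
  \<comment> \<open>The kernel condition in matrix form: \<open>w - P R w\<close> lies in
    \<open>ker R\<close>, hence in \<open>ker N\<close>.\<close>
  have NPR: "N ** P ** R = N"
  proof -
    have "N *v (w - P *v (R *v w)) = 0" for w
      using proj ker by (auto simp: mat_ker_def N_def)
    then show ?thesis
      by (simp add: matrix_eq matrix_vector_mult_diff_distrib matrix_vector_mul_assoc matrix_mul_assoc)
  qed
  \<comment> \<open>This serves to obtain \<open>R K = R P N^T = (N R P)^T = N^T\<close>, using that
    \<open>R P\<close> is symmetric. Transposing \<open>R P R = R\<close> gives
    \<open>R R P = R\<close>, and so \<open>N R P = N P R R P = N P R = N\<close>.\<close>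
  have "N ** (R ** P) = N"
  proof -
    have "R ** (R ** P) = R"
      using arg_cong[OF RPR, of transpose] by (simp add: matrix_transpose_mul trR)
        (metis RP matrix_transpose_mul trR)
    then show ?thesis by (metis NPR matrix_mul_assoc)
  qed
  then have RK: "R ** K = transpose N"
    unfolding K_def by (metis RP matrix_mul_assoc matrix_transpose_mul)
  have kerD: "mat_ker R = mat_ker D" by (simp add: R ker_transpose_mult_self)
  let ?F = "A - B ** K" and ?C = "C - D ** K"
  have ker_X: "?C *v v = 0 \<and> X *v (?F *v v) = 0" if "X *v v = 0" for v
  proof -
    have "X *v (A *v v) + transpose A *v (X *v v) - N *v (K *v v) + Q *v v = 0"
      using arg_cong[OF care, of "\<lambda>M. M *v v"]
      by (simp add: matrix_vector_mult_add_rdistrib matrix_vector_mult_diff_rdistrib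
          matrix_vector_mul_assoc matrix_mul_assoc K_def N_def[symmetric] P_def[symmetric] trN[symmetric])
    \<comment> \<open>\<open>X v = 0\<close> removes the term with \<open>transpose A\<close>, and
      \<open>N = S + X B\<close> splits the quadratic term.\<close>
    then have "X *v (A *v v) = S *v (K *v v) + X *v (B *v (K *v v)) - Q *v v"
      by (simp add: N_def matrix_vector_mult_add_rdistrib that flip: matrix_vector_mul_assoc)
        (simp add: algebra_simps)
    then have XF: "X *v (?F *v v) = - (transpose C *v (?C *v v))"
      by (simp add: Q S matrix_vector_mult_diff_rdistrib matrix_vector_mult_diff_distrib
          flip: matrix_vector_mul_assoc)
    have "transpose D *v (?C *v v) = transpose S *v v - R *v (K *v v)"
      by (simp add: R S matrix_transpose_mul matrix_vector_mult_diff_rdistrib matrix_vector_mult_diff_distrib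
          flip: matrix_vector_mul_assoc)
    \<comment> \<open>For \<open>X v = 0\<close> the vectors \<open>S^T v\<close> and
      \<open>N^T v\<close> agree, and \<open>N^T = R K\<close>.\<close>
    also have "\<dots> = 0"
      using that by (simp add: matrix_vector_mul_assoc RK trN matrix_vector_mult_add_rdistrib)
        (simp flip: matrix_vector_mul_assoc)
    finally have D0: "transpose D *v (?C *v v) = 0" .
    have "(?C *v v) \<bullet> (?C *v v) = v \<bullet> (transpose C *v (?C *v v)) - (K *v v) \<bullet> (transpose D *v (?C *v v))"
      by (simp add: matrix_vector_mult_diff_rdistrib inner_diff_left inner_vector_matrix_mult
          flip: matrix_vector_mul_assoc)
    also have "\<dots> = - (v \<bullet> (X *v (?F *v v)))" by (simp add: D0 XF del: transpose_matrix_vector)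
    also have "v \<bullet> (X *v (?F *v v)) = (X *v v) \<bullet> (?F *v v)"
      using X by (metis dot_lmul_matrix vector_transpose_matrix)
    finally have "?C *v v = 0" using that by simp
    then show ?thesis using XF by simp
  qed
  have ctrb: "controllable_subspace ?F ((*v) B ` mat_ker D) \<subseteq> mat_ker X"
  proof (rule controllable_subspace_least)
    show "subspace (mat_ker X)"
      unfolding mat_ker_def subspace_def by (simp add: matrix_vector_right_distrib matrix_vector_mult_scaleR)
    show "?F *v v \<in> mat_ker X" if "v \<in> mat_ker X" for v using ker_X that by (simp add: mat_ker_def)
    have "X *v (B *v w) = 0" if w: "w \<in> mat_ker D" for w
    proof -
      \<comment> \<open>Both \<open>N w\<close> and \<open>S w = C^T D w\<close> vanish, so their
        difference \<open>X B w\<close> does as well.\<close>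
      have "w \<in> mat_ker N" using w ker unfolding kerD N_def by blast
      then have "N *v w = 0" by (simp add: mat_ker_def)
      moreover have "S *v w = 0" using w by (simp add: S mat_ker_def flip: matrix_vector_mul_assoc)
      ultimately show ?thesis
        by (simp add: N_def matrix_vector_mult_add_rdistrib flip: matrix_vector_mul_assoc)
    qed
    then show "(*v) B ` mat_ker D \<subseteq> mat_ker X" by (auto simp: mat_ker_def)
  qed
  interpret output_nulling_feedback A B C D K
  proof
    fix v assume "v \<in> controllable_subspace ?F ((*v) B ` mat_ker D)"
    then have "X *v v = 0" using ctrb by (auto simp: mat_ker_def)
    then show "?C *v v = 0" using ker_X by blast
  qed
  show ?thesis
  proof (rule S_star_eq_R_star)
    fix w
    have "(- M) *v y = - (M *v y)" for M :: "real^'p^'n" and y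
      using matrix_vector_mult_diff_rdistrib[of 0 M y] by simp
    \<comment> \<open>Because \<open>D^T D = R\<close>, this choice of \<open>L\<close> replaces
      \<open>w\<close> by \<open>w - P R w\<close>, which lies in
      \<open>ker R = ker D\<close>.\<close>
    then have "(B + (- (B ** P ** transpose D)) ** D) *v w = B *v (w - P *v (R *v w))"
      by (simp add: R matrix_vector_mult_add_rdistrib matrix_vector_mult_diff_distrib
          flip: matrix_vector_mul_assoc)
    then show "(B + (- (B ** P ** transpose D)) ** D) *v w \<in> R\<^sub>0"
      using subsetD[OF subset_controllable_subspace imageI[OF proj[of w, unfolded kerD]]] by metis
  qed
qed

end
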